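(* Let $k\ge 1$ and $N\ge 1$ be integers and let $L\in\{1,2,\dots,N\}$. Define the formal power series $$F_N(z)=\sum_{m=0}^{\infty}\frac{(Nm)!^k}{m!^{kN}}z^m,\qquad G_{L,N}(z)=\sum_{m=1}^{\infty}H_{Lm}\frac{(Nm)!^k}{m!^{kN}}z^m,$$ where $H_n=\sum_{i=1}^n 1/i$ is the $n$-th harmonic number, and let $q_{L,N}(z)=\exp\big(G_{L,N}(z)/F_N(z)\big)$. Then $q_{L,N}(z)\in\mathbb{Z}[[z]]$.
   Context: All power series are formal power series in $z$; since $F_N(z)\in 1+z\mathbb{Z}[[z]]$ and $G_{L,N}(z)\in z\mathbb{Q}[[z]]$, the exponential is well defined in $1+z\mathbb{Q}[[z]]$. *)

theory Defs
  imports "HOL-Computational_Algebra.Formal_Power_Series"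
begin

(* The library's harm is restricted to real_normed_field, which excludes rat. *)
definition harmonic :: "nat \<Rightarrow> rat" where
  "harmonic n = (\<Sum>i = 1..n. 1 / of_nat i)"

definition F_ser :: "nat \<Rightarrow> nat \<Rightarrow> rat fps" where
  "F_ser k N = Abs_fps (\<lambda>m. fact (N * m) ^ k / fact m ^ (k * N))"

definition G_ser :: "nat \<Rightarrow> nat \<Rightarrow> nat \<Rightarrow> rat fps" where
  "G_ser k L N = Abs_fps (\<lambda>m. if m = 0 then 0
     else harmonic (L * m) * (fact (N * m) ^ k / fact m ^ (k * N)))"

lemma F_ser_nth_0 [simp]: "fps_nth (F_ser k N) 0 = 1"
  by (simp add: F_ser_def)

lemma G_ser_nth_0 [simp]: "fps_nth (G_ser k L N) 0 = 0"
  by (simp add: G_ser_def)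

(* As F_ser has constant term 1, division is multiplication by the inverse series. *)
lemma G_ser_divide_F_ser: "G_ser k L N / F_ser k N = G_ser k L N * inverse (F_ser k N)"
  by (simp add: fps_divide_unit)

(* fps_compose f g is the substitution of g into f only if g has constant term 0. *)
lemma G_ser_divide_F_ser_nth_0 [simp]: "fps_nth (G_ser k L N / F_ser k N) 0 = 0"
  by (simp add: G_ser_divide_F_ser)

definition q_ser :: "nat \<Rightarrow> nat \<Rightarrow> nat \<Rightarrow> rat fps" where
  "q_ser k L N = fps_exp 1 oo (G_ser k L N / F_ser k N)"

end

theory Submission
  imports Defs "HOL-Number_Theory.Number_Theory" "HOL-Computational_Algebra.Formal_Laurent_Series"
begin

text \<open>
  It suffices to show that the coefficients are \<open>p\<close>-integral for every prime \<open>p\<close>. By Dwork's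
  exponential lemma, \<open>exp S\<close> is \<open>p\<close>-integral as soon as \<open>p S(z) - S(z\<^sup>p)\<close> has coefficients
  in \<open>p \<int>\<^sub>p\<close>. For \<open>S = G/F\<close> this is a congruence for sums of products \<open>A(i) A(j) H(L j)\<close>, where
  \<open>A(m) = ((N m)! / m!\<^sup>N)\<^sup>k\<close>. It follows from Dwork's congruences for the block sums
  \<open>U a K s m\<close> over \<open>m p\<^sup>s \<le> j < (m + 1) p\<^sup>s\<close>, which lie in \<open>p\<^bsup>s+1\<^esup> A(m) \<int>\<^sub>p\<close>: by induction on \<open>s\<close>,
  the factor \<open>H(L j)\<close> may be replaced by its value at the left end of the block, the error made in
  passing from level \<open>s\<close> to \<open>s + 1\<close> being absorbed by \<open>A(m)\<close> and by the factor \<open>p\<^bsup>s+1\<^esup>\<close>.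
\<close>

subsection \<open>Rational numbers integral at a prime\<close>

locale padic =
  fixes p :: nat
  assumes prime_p: "prime p"
begin

text \<open>The localization of the integers at \<open>p\<close>; it stands in for the
  \<open>p\<close>-adic integers, as all quantities here are rational.\<close>

definition Zp :: "rat set" where
  "Zp = {x. \<exists>a b :: int. \<not> int p dvd b \<and> x = of_int a / of_int b}"

text \<open>The principal fractional ideal of \<open>c\<close>: \<open>x \<equiv> y\<close> modulo \<open>c\<close> is written \<open>x - y \<in> pid c\<close>.\<close>

definition pid :: "rat \<Rightarrow> rat set" where
  "pid c = (\<lambda>y. c * y) ` Zp"

lemma prime_int_p: "prime (int p)"
  using prime_p by simp

lemma p_nonzero [simp]: "p \<noteq> 0" "p > 0"
  using prime_p by (auto simp: prime_gt_0_nat)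

lemma ZpI: "\<not> int p dvd b \<Longrightarrow> x = of_int a / of_int b \<Longrightarrow> x \<in> Zp"
  by (auto simp: Zp_def)

lemma Zp_of_int [simp]: "of_int a \<in> Zp"
  using prime_int_p by (intro ZpI[of 1 _ a]) (auto simp: not_prime_unit)

lemma Zp_of_nat [simp]: "of_nat a \<in> Zp"
  using Zp_of_int[of "int a"] by simp

lemma Zp_0 [simp]: "0 \<in> Zp" and Zp_1 [simp]: "1 \<in> Zp"
  using Zp_of_int[of 0] Zp_of_int[of 1] by auto

lemma Zp_add [intro]:
  assumes "x \<in> Zp" "y \<in> Zp" shows "x + y \<in> Zp"
proof -
  obtain a b c d where ab: "\<not> int p dvd b" "x = of_int a / of_int b"
    and cd: "\<not> int p dvd d" "y = of_int c / of_int d"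
    using assms by (auto simp: Zp_def)
  have "b \<noteq> 0" "d \<noteq> 0" using ab cd by auto
  then have "x + y = of_int (a * d + c * b) / of_int (b * d)"
    using ab cd by (simp add: field_simps)
  moreover have "\<not> int p dvd b * d"
    using ab cd prime_int_p by (simp add: prime_dvd_mult_iff)
  ultimately show ?thesis by (rule ZpI[rotated])
qed

lemma Zp_mult [intro]:
  assumes "x \<in> Zp" "y \<in> Zp" shows "x * y \<in> Zp"
proof -
  obtain a b c d where ab: "\<not> int p dvd b" "x = of_int a / of_int b"
    and cd: "\<not> int p dvd d" "y = of_int c / of_int d"
    using assms by (auto simp: Zp_def)
  have "x * y = of_int (a * c) / of_int (b * d)"
    using ab cd by simp
  moreover have "\<not> int p dvd b * d"
    using ab cd prime_int_p by (simp add: prime_dvd_mult_iff)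
  ultimately show ?thesis by (rule ZpI[rotated])
qed

lemma Zp_uminus [intro]: "x \<in> Zp \<Longrightarrow> - x \<in> Zp"
  using Zp_mult[OF Zp_of_int[of "-1"]] by simp

lemma Zp_diff [intro]: "x \<in> Zp \<Longrightarrow> y \<in> Zp \<Longrightarrow> x - y \<in> Zp"
  using Zp_add[OF _ Zp_uminus] by simp

lemma Zp_power [intro]: "x \<in> Zp \<Longrightarrow> x ^ n \<in> Zp"
  by (induction n) auto

lemma Zp_sum [intro]: "(\<And>i. i \<in> I \<Longrightarrow> f i \<in> Zp) \<Longrightarrow> sum f I \<in> Zp"
  by (induction I rule: infinite_finite_induct) auto

lemma Zp_inverse_of_nat: "\<not> p dvd n \<Longrightarrow> 1 / of_nat n \<in> Zp"
  by (rule ZpI[of "int n" _ 1]) auto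

lemma pidI: "y \<in> Zp \<Longrightarrow> x = c * y \<Longrightarrow> x \<in> pid c"
  by (auto simp: pid_def)

lemma pid_1 [simp]: "pid 1 = Zp"
  by (auto simp: pid_def)

lemma pid_0 [simp]: "0 \<in> pid c"
  by (rule pidI[OF Zp_0]) simp

lemma pid_self [simp]: "c \<in> pid c"
  by (rule pidI[OF Zp_1]) simp

lemma pid_add [intro]: "x \<in> pid c \<Longrightarrow> y \<in> pid c \<Longrightarrow> x + y \<in> pid c"
  by (auto simp: pid_def simp flip: distrib_left)

lemma pid_uminus [intro]: "x \<in> pid c \<Longrightarrow> - x \<in> pid c"
  by (auto simp: pid_def intro!: image_eqI[where x = "- _"])

lemma pid_diff [intro]: "x \<in> pid c \<Longrightarrow> y \<in> pid c \<Longrightarrow> x - y \<in> pid c"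
  by (auto simp: pid_def simp flip: right_diff_distrib)

lemma pid_sum [intro]: "(\<And>i. i \<in> I \<Longrightarrow> f i \<in> pid c) \<Longrightarrow> sum f I \<in> pid c"
  by (induction I rule: infinite_finite_induct) auto

lemma pid_mult [intro]: "x \<in> pid c \<Longrightarrow> y \<in> pid d \<Longrightarrow> x * y \<in> pid (c * d)"
proof -
  assume "x \<in> pid c" "y \<in> pid d"
  then obtain u v where "x = c * u" "y = d * v" "u \<in> Zp" "v \<in> Zp"
    by (auto simp: pid_def)
  then show ?thesis by (intro pidI[of "u * v"]) auto
qed

lemma pid_mult_left: "x \<in> Zp \<Longrightarrow> y \<in> pid c \<Longrightarrow> x * y \<in> pid c"
  using pid_mult[of x 1 y c] by simp

lemma pid_mult_right: "y \<in> pid c \<Longrightarrow> x \<in> Zp \<Longrightarrow> y * x \<in> pid c"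
  using pid_mult[of y c x 1] by simp

lemma pid_trans: "x \<in> pid c \<Longrightarrow> c \<in> pid d \<Longrightarrow> x \<in> pid d"
  by (auto simp: pid_def mult.assoc)

lemma pid_subset_Zp: "x \<in> pid c \<Longrightarrow> c \<in> Zp \<Longrightarrow> x \<in> Zp"
  by (auto simp: pid_def)

lemma pid_p_Zp: "x \<in> pid (of_nat p) \<Longrightarrow> x \<in> Zp"
  by (rule pid_subset_Zp) auto

lemma pid_cancel: "c \<noteq> 0 \<Longrightarrow> c * x \<in> pid (c * d) \<longleftrightarrow> x \<in> pid d"
  by (auto simp: pid_def mult.assoc)

lemma pid_cancel1: "c \<noteq> 0 \<Longrightarrow> c * x \<in> pid c \<longleftrightarrow> x \<in> Zp"
  using pid_cancel[of c x 1] by simp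

lemma pid_power_diff:
  assumes "x - y \<in> pid c" "x \<in> Zp" "y \<in> Zp"
  shows "x ^ n - y ^ n \<in> pid c"
proof (induction n)
  case (Suc n)
  have "x ^ Suc n - y ^ Suc n = x * (x ^ n - y ^ n) + (x - y) * y ^ n"
    by (simp add: algebra_simps)
  also have "\<dots> \<in> pid c"
    using assms Suc by (intro pid_add pid_mult_left pid_mult_right) auto
  finally show ?case .
qed auto

text \<open>The difference is \<open>P * Q' - P' * Q\<close> over the unit \<open>Q * Q'\<close>, so
  cross-multiplied integer congruences pass to fractions.\<close>

lemma pid_cong_of_int:
  assumes "[P * Q' = P' * Q] (mod int p ^ s)" "\<not> int p dvd Q" "\<not> int p dvd Q'"
  shows "(of_int P / of_int Q :: rat) - of_int P' / of_int Q' \<in> pid (of_nat p ^ s)"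
proof -
  obtain t where t: "P * Q' - P' * Q = int p ^ s * t"
    using assms(1) by (auto simp: cong_iff_dvd_diff)
  have nz: "Q \<noteq> 0" "Q' \<noteq> 0" using assms by auto
  have "(of_int P / of_int Q :: rat) - of_int P' / of_int Q' = of_int (P * Q' - P' * Q) / of_int (Q * Q')"
    using nz by (simp add: field_simps)
  also have "\<dots> = of_nat p ^ s * (of_int t / of_int (Q * Q'))"
    unfolding t by simp
  finally show ?thesis
    by (rule pidI[rotated])
      (rule ZpI[of "Q * Q'" _ t], use assms prime_int_p in \<open>auto simp: prime_dvd_mult_iff\<close>)
qed

end

subsection \<open>Dwork's congruences\<close>

lemma sum_blocks:
  fixes f :: "nat \<Rightarrow> 'a :: comm_monoid_add"
  shows "(\<Sum>i<d. sum f {(x + i) * c..<(x + i + 1) * c}) = sum f {x * c..<(x + d) * c}"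
proof (induction d)
  case (Suc d)
  have "(\<Sum>i<Suc d. sum f {(x + i) * c..<(x + i + 1) * c})
      = sum f {x * c..<(x + d) * c} + sum f {(x + d) * c..<(x + d + 1) * c}"
    by (simp only: sum.lessThan_Suc Suc)
  also have "\<dots> = sum f {x * c..<(x + d + 1) * c}"
    by (rule sum.atLeastLessThan_concat) auto
  finally show ?case by simp
qed simp

lemma sum_interval_shift:
  fixes f :: "nat \<Rightarrow> 'a :: comm_monoid_add"
  shows "sum f {x * c..<(x + 1) * c} = (\<Sum>i<c. f (i + x * c))"
  using sum.shift_bounds_nat_ivl[of f 0 "x * c" c]
  by (simp add: add.commute atLeast0LessThan)

text \<open>Splits off the lowest base-\<open>c\<close> digit \<open>i\<close> of the summation
  index.\<close>

lemma sum_prime_digits: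
  fixes f :: "nat \<Rightarrow> 'a :: comm_monoid_add"
  shows "(\<Sum>u<r. \<Sum>i<c. f (i + c * u)) = (\<Sum>j<r * c. f j)"
  using sum_blocks[where f = f and d = r and x = 0 and c = c]
  unfolding add_0 sum_interval_shift mult_0
  by (simp add: mult.commute atLeast0LessThan sum_interval_shift[simplified])

text \<open>\<open>R\<close> is the ratio between \<open>A (v + p * w)\<close> and \<open>A w\<close>; Dwork's hypothesis is that it
  depends \<open>p\<close>-adically continuously on \<open>w\<close>.\<close>

locale dwork_sequence = padic +
  fixes A :: "nat \<Rightarrow> rat" and R :: "nat \<Rightarrow> nat \<Rightarrow> rat"
  assumes A_0: "A 0 = 1"
    and A_nonzero: "A m \<noteq> 0"
    and A_Zp: "A m \<in> Zp"
    and A_step: "v < p \<Longrightarrow> A (v + p * w) = A w * R v w"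
    and R_Zp: "v < p \<Longrightarrow> R v w \<in> Zp"
    and R_cong: "v < p \<Longrightarrow> R v (u + n * p ^ s) - R v u \<in> pid (of_nat p ^ Suc s)"
begin

text \<open>Each use of \<open>A_step\<close> strips the lowest base-\<open>p\<close> digit at the
  cost of an integral factor \<open>R\<close>; after \<open>s\<close> digits \<open>A n\<close>
  remains.\<close>

lemma A_digits: "u < p ^ s \<Longrightarrow> A (u + n * p ^ s) \<in> pid (A n)"
proof (induction s arbitrary: u)
  case (Suc s)
  have *: "u + n * p ^ Suc s = u mod p + p * (u div p + n * p ^ s)"
    by (simp add: algebra_simps)
  have "u div p < p ^ s"
    using Suc.prems by (simp add: less_mult_imp_div_less mult.commute)
  then have "A (u div p + n * p ^ s) * R (u mod p) (u div p + n * p ^ s) \<in> pid (A n)"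
    using Suc.IH R_Zp by (intro pid_mult_right) auto
  then show ?case
    unfolding * by (subst A_step) auto
qed auto

text \<open>Dwork's congruence for ratios, cleared of denominators. The factor \<open>A n\<close> of
  the modulus, supplied by \<open>A_digits\<close>, lets the induction for
  \<open>dwork_congruence\<close> reproduce itself.\<close>

lemma A_cong:
  assumes "v < p" "u < p ^ s"
  shows "A (v + p * (u + n * p ^ s)) - A (u + n * p ^ s) * R v u \<in> pid (of_nat p ^ Suc s * A n)"
proof -
  have "A (v + p * (u + n * p ^ s)) - A (u + n * p ^ s) * R v u
      = (R v (u + n * p ^ s) - R v u) * A (u + n * p ^ s)"
    unfolding A_step[OF assms(1)] by (simp add: algebra_simps)
  also have "\<dots> \<in> pid (of_nat p ^ Suc s * A n)"
    using R_cong A_digits assms by (intro pid_mult) auto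
  finally show ?thesis .
qed

text \<open>The value 0 above \<open>K\<close> lets blocks run past \<open>K\<close> in spite of
  truncated subtraction.\<close>

definition D :: "nat \<Rightarrow> nat \<Rightarrow> nat \<Rightarrow> rat" where
  "D a K j = (if j \<le> K then A (a + p * (K - j)) * A j - A (K - j) * A (a + p * j) else 0)"

definition U :: "nat \<Rightarrow> nat \<Rightarrow> nat \<Rightarrow> nat \<Rightarrow> rat" where
  "U a K s m = sum (D a K) {m * p ^ s..<(m + 1) * p ^ s}"

lemma U_Suc: "U a K (Suc s) m = (\<Sum>i<p. U a K s (i + p * m))"
  using sum_blocks[where f = "D a K" and d = p and x = "p * m" and c = "p ^ s"]
  unfolding U_def by (simp add: algebra_simps)

text \<open>Termwise, the first products coincide; by \<open>A_step\<close> the second ones differ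
  by \<open>A (K - j)\<close> times the error bounded in \<open>A_cong\<close>.\<close>

lemma U_shift_base:
  assumes a: "a < p"
  shows "U a (K + m * p ^ s) s m - (\<Sum>j<p ^ s. A (j + m * p ^ s) / A j * U a K 0 j)
      \<in> pid (of_nat p ^ Suc s * A m)"
proof -
  have "D a (K + m * p ^ s) (j + m * p ^ s) - A (j + m * p ^ s) / A j * D a K j
      \<in> pid (of_nat p ^ Suc s * A m)" if "j < p ^ s" for j
  proof (cases "j \<le> K")
    case True
    have "D a (K + m * p ^ s) (j + m * p ^ s) - A (j + m * p ^ s) / A j * D a K j
       = - A (K - j) * (A (a + p * (j + m * p ^ s)) - A (j + m * p ^ s) * R a j)"
      unfolding D_def A_step[OF a] using True A_nonzero[of j] by (simp add: field_simps)
    also have "\<dots> \<in> pid (of_nat p ^ Suc s * A m)"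
      using A_cong[OF a that] A_Zp by (intro pid_mult_left) auto
    finally show ?thesis .
  qed (simp add: D_def)
  then have "(\<Sum>j<p ^ s. D a (K + m * p ^ s) (j + m * p ^ s) - A (j + m * p ^ s) / A j * D a K j)
      \<in> pid (of_nat p ^ Suc s * A m)" by (intro pid_sum) auto
  then show ?thesis
    unfolding U_def sum_interval_shift[of "D a (K + m * p ^ s)"] sum_subtractf by simp
qed

text \<open>Dwork's interpolation between \<open>t = 0\<close> and \<open>t = s\<close>: the last case reads
  \<open>U a (K + m p\<^sup>s) s m \<equiv> A m * U a K s 0\<close>.\<close>

lemma U_shift:
  assumes a: "a < p" and "t \<le> s"
    and dvd: "\<And>t' a K m. t' < s \<Longrightarrow> a < p \<Longrightarrow> U a K t' m \<in> pid (of_nat p ^ Suc t' * A m)"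
  shows "U a (K + m * p ^ s) s m
      - (\<Sum>j<p ^ (s - t). A (j + m * p ^ (s - t)) / A j * U a K t j) \<in> pid (of_nat p ^ Suc s * A m)"
  using \<open>t \<le> s\<close>
proof (induction t)
  case 0
  then show ?case using U_shift_base[OF a] by simp
next
  case (Suc t)
  define r where "r = s - Suc t"
  have r: "s - t = Suc r" "s - Suc t = r" using Suc.prems by (auto simp: r_def)
  let ?h = "\<lambda>j. A (j + m * p ^ Suc r) / A j * U a K t j"
  have "(\<Sum>j<p ^ Suc r. ?h j) = (\<Sum>u<p ^ r. \<Sum>i<p. ?h (i + p * u))"
    by (subst sum_prime_digits) (simp add: mult.commute)
  moreover have "(\<Sum>i<p. ?h (i + p * u)) - A (u + m * p ^ r) / A u * U a K (Suc t) u
      \<in> pid (of_nat p ^ Suc s * A m)" if u: "u < p ^ r" for u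
  proof -
    have "?h (i + p * u) - A (u + m * p ^ r) / A u * U a K t (i + p * u)
       \<in> pid (of_nat p ^ Suc s * A m)" if i: "i < p" for i
    proof -
      \<comment> \<open>By \<open>dvd\<close> the denominator \<open>A (i + p * u)\<close> cancels,
        leaving \<open>p ^ Suc t\<close> times the error of \<open>A_cong\<close> at level
        \<open>r\<close>; the exponents add up to \<open>Suc s\<close>.\<close>
      obtain y where y: "y \<in> Zp" "U a K t (i + p * u) = of_nat p ^ Suc t * A (i + p * u) * y"
        using dvd[of t a K "i + p * u"] Suc.prems a by (auto simp: pid_def)
      have eq: "i + p * u + m * p ^ Suc r = i + p * (u + m * p ^ r)"
        by (simp add: algebra_simps)
      have nz: "A u \<noteq> 0" "R i u \<noteq> 0"
        using A_nonzero[of "i + p * u"] A_nonzero[of u] A_step[OF i, of u] by auto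
      have "?h (i + p * u) - A (u + m * p ^ r) / A u * U a K t (i + p * u)
          = (of_nat p ^ Suc t * y) * (A (i + p * (u + m * p ^ r)) - A (u + m * p ^ r) * R i u)"
        unfolding eq y(2) using nz i A_step[OF i, of u] by (simp add: field_simps)
      also have "\<dots> \<in> pid (of_nat p ^ Suc t * (of_nat p ^ Suc r * A m))"
        using A_cong[OF i u] y(1) by (intro pid_mult pid_mult_right) auto
      also have "of_nat p ^ Suc t * (of_nat p ^ Suc r * A m) = of_nat p ^ Suc s * A m"
        using Suc.prems by (simp add: r_def flip: power_add mult.assoc power_Suc)
      finally show ?thesis .
    qed
    then have "(\<Sum>i<p. ?h (i + p * u) - A (u + m * p ^ r) / A u * U a K t (i + p * u))
        \<in> pid (of_nat p ^ Suc s * A m)" by (intro pid_sum) auto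
    then show ?thesis by (simp add: sum_subtractf U_Suc sum_distrib_left)
  qed
  then have "(\<Sum>u<p ^ r. (\<Sum>i<p. ?h (i + p * u)) - A (u + m * p ^ r) / A u * U a K (Suc t) u)
      \<in> pid (of_nat p ^ Suc s * A m)" by (intro pid_sum) auto
  ultimately have "(\<Sum>j<p ^ Suc r. ?h j)
      - (\<Sum>u<p ^ r. A (u + m * p ^ r) / A u * U a K (Suc t) u) \<in> pid (of_nat p ^ Suc s * A m)"
    by (simp add: sum_subtractf)
  from pid_add[OF Suc.IH this[folded r(1)]] Suc.prems show ?case
    by (simp add: r)
qed

text \<open>The reflection \<open>j \<mapsto> K - j\<close> exchanges the two products in \<open>D a K j\<close>. With the
  shift congruence this gives \<open>U a K s 0 \<equiv> 0\<close> by induction on \<open>K\<close>.\<close>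

lemma sum_U_eq_0: "(\<Sum>m<Suc K. U a K s m) = 0"
proof -
  have "(\<Sum>m<Suc K. U a K s m) = sum (D a K) {0..<Suc K * p ^ s}"
    using sum_blocks[where f = "D a K" and d = "Suc K" and x = 0 and c = "p ^ s"]
    by (simp add: U_def)
  also have "\<dots> = sum (D a K) {0..K}"
  proof (rule sum.mono_neutral_right)
    \<comment> \<open>Blocks have length at least 1, so \<open>Suc K\<close> of them cover all
      indices where \<open>D\<close> can be nonzero.\<close>
    have "Suc K * 1 \<le> Suc K * p ^ s" by (rule mult_le_mono2) (simp add: Suc_le_eq)
    then show "{0..K} \<subseteq> {0..<Suc K * p ^ s}" by auto
  qed (auto simp: D_def)
  also have "\<dots> = (\<Sum>j=0..K. A (a + p * (K - j)) * A j) - (\<Sum>j=0..K. A (K - j) * A (a + p * j))"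
    by (simp add: D_def sum_subtractf)
  also have "(\<Sum>j=0..K. A (K - j) * A (a + p * j)) = (\<Sum>j=0..K. A (a + p * (K - j)) * A j)"
    by (subst sum.atLeastAtMost_rev) (auto intro!: sum.cong)
  finally show ?thesis by simp
qed

theorem dwork_congruence: "a < p \<Longrightarrow> U a K s m \<in> pid (of_nat p ^ Suc s * A m)"
proof (induction s arbitrary: a K m rule: less_induct)
  case (less s)
  note a = \<open>a < p\<close>
  \<comment> \<open>At \<open>t = s\<close> the sum in \<open>U_shift\<close> has the single index
    \<open>j = 0\<close>, and \<open>A 0 = 1\<close>.\<close>
  have shift: "U a (K + m * p ^ s) s m - A m * U a K s 0 \<in> pid (of_nat p ^ Suc s * A m)" for K m
    using U_shift[OF a order_refl less.IH, of s K m] by (simp add: A_0)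
  have small: "U a K s m = 0" if "K < m * p ^ s" for K m
    unfolding U_def using that by (intro sum.neutral) (auto simp: D_def)
  \<comment> \<open>Reduces block \<open>m\<close> to block 0 with \<open>K\<close> lowered by
    \<open>m * p ^ s\<close>; a block beyond \<open>K\<close> vanishes.\<close>
  have step: "U a K s m \<in> pid (of_nat p ^ Suc s * A m)"
    if "m * p ^ s \<le> K \<Longrightarrow> U a (K - m * p ^ s) s 0 \<in> pid (of_nat p ^ Suc s)" for K m
  proof (cases "m * p ^ s \<le> K")
    case True
    have "A m * U a (K - m * p ^ s) s 0 \<in> pid (A m * of_nat p ^ Suc s)"
      using that[OF True] by (intro pid_mult) auto
    from pid_add[OF shift[of "K - m * p ^ s" m] this[unfolded mult.commute[of "A m" "_ ^ _"]]]
    show ?thesis using True by simp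
  qed (simp add: small)
  \<comment> \<open>Blocks after the first lower \<open>K\<close> and are settled by induction;
    block 0 is minus their sum, since the total is 0.\<close>
  have zero: "U a K s 0 \<in> pid (of_nat p ^ Suc s)" for K
  proof (induction K rule: less_induct)
    case (less K)
    have "U a K s (Suc m) \<in> pid (of_nat p ^ Suc s)" for m
    proof -
      have "U a K s (Suc m) \<in> pid (of_nat p ^ Suc s * A (Suc m))"
      proof (rule step, rule less)
        assume "Suc m * p ^ s \<le> K"
        moreover have "0 < Suc m * p ^ s" by simp
        ultimately show "K - Suc m * p ^ s < K" by linarith
      qed
      then show ?thesis by (rule pid_trans) (intro pid_mult_right pid_self A_Zp)
    qed
    then have "(\<Sum>m<K. U a K s (Suc m)) \<in> pid (of_nat p ^ Suc s)" by (intro pid_sum) auto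
    moreover have "U a K s 0 = - (\<Sum>m<K. U a K s (Suc m))"
      using sum_U_eq_0[of a K s] unfolding sum.lessThan_Suc_shift by (simp add: eq_neg_iff_add_eq_0)
    ultimately show ?case by auto
  qed
  show ?case by (rule step) (rule zero)
qed

end

subsection \<open>Multinomial coefficients and harmonic numbers\<close>

definition multinom :: "nat \<Rightarrow> nat \<Rightarrow> rat" where
  "multinom N m = fact (N * m) / fact m ^ N"

lemma multinom_nonzero [simp]: "multinom N m \<noteq> 0"
  by (simp add: multinom_def)

lemma multinom_Suc: "multinom (Suc N) m = multinom N m * of_nat ((m + N * m) choose m)"
proof -
  have "(fact (m + N * m) :: rat) = fact m * fact (N * m) * of_nat ((m + N * m) choose m)"
    using binomial_fact_lemma[of m "m + N * m"]
    by (metis add_diff_cancel_left' le_add1 of_nat_fact of_nat_mult)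
  then show ?thesis by (simp add: multinom_def)
qed

text \<open>Each step of \<open>N\<close> multiplies by the binomial coefficient of
  \<open>multinom_Suc\<close>.\<close>

lemma multinom_dvd: "L \<le> N \<Longrightarrow> \<exists>c. multinom N m = multinom L m * of_nat c"
proof (induction N rule: dec_induct)
  case base
  then show ?case by (intro exI[of _ 1]) simp
next
  case (step N)
  then show ?case unfolding multinom_Suc by (metis mult.assoc of_nat_mult)
qed

lemma multinom_nat: "\<exists>c. multinom N m = of_nat c"
  using multinom_dvd[of 0 N m] by (simp add: multinom_def)

lemma fact_add_prod: "fact (x + n) = (fact x :: nat) * (\<Prod>i = 1..n. x + i)"
  by (induction n) (auto simp: algebra_simps)

lemma harmonic_add: "harmonic (x + n) = harmonic x + (\<Sum>i = 1..n. 1 / of_nat (x + i))"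
  by (induction n) (auto simp: harmonic_def)

section \<open>Factorials with the multiples of \<open>p\<close> removed\<close>

context padic
begin

definition prime_block :: "nat \<Rightarrow> nat" where
  "prime_block w = (\<Prod>i = 1..<p. p * w + i)"

text \<open>The product of the integers below \<open>p * M\<close> prime to \<open>p\<close>: up to
  sign, Morita's \<open>p\<close>-adic Gamma function at \<open>p * M\<close>.\<close>

definition prime_fact :: "nat \<Rightarrow> nat" where
  "prime_fact M = (\<Prod>w<M. prime_block w)"

lemma not_dvd_block: "0 < i \<Longrightarrow> i < p \<Longrightarrow> \<not> p dvd p * w + i"
  by (metis dvd_add_right_iff dvd_triv_left nat_dvd_not_less)

lemma not_dvd_prod:
  fixes f :: "'a \<Rightarrow> nat"
  shows "(\<And>i. i \<in> I \<Longrightarrow> \<not> p dvd f i) \<Longrightarrow> \<not> p dvd prod f I"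
  using prime_p by (induction I rule: infinite_finite_induct) (auto simp: prime_dvd_mult_iff)

lemma prime_fact_not_dvd: "\<not> p dvd prime_fact M"
  unfolding prime_fact_def prime_block_def by (intro not_dvd_prod not_dvd_block) auto

text \<open>The multiples of \<open>p\<close> up to \<open>p * M\<close> contribute
  \<open>p ^ M * fact M\<close>.\<close>

lemma fact_p_mult: "fact (p * M) = p ^ M * fact M * prime_fact M"
proof (induction M)
  case (Suc M)
  have *: "{1..p} = insert p {1..<p}" using p_nonzero(2) by (auto simp del: p_nonzero)
  have "fact (p * Suc M) = (fact (p * M + p) :: nat)" by (simp add: algebra_simps)
  also have "\<dots> = fact (p * M) * (prime_block M * (p * M + p))"
    unfolding fact_add_prod prime_block_def * by simp
  also have "\<dots> = p ^ Suc M * fact (Suc M) * prime_fact (Suc M)"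
    unfolding Suc by (simp add: prime_fact_def algebra_simps)
  finally show ?case .
qed (simp add: prime_fact_def)

lemma prime_fact_add: "prime_fact (x + M) = prime_fact x * (\<Prod>w<M. prime_block (x + w))"
  by (induction M) (auto simp: prime_fact_def)

text \<open>The factor \<open>p\<close> in front of \<open>w\<close> raises the exponent of the
  modulus from \<open>s\<close> to \<open>Suc s\<close>; all later gains of one power start
  here.\<close>

lemma block_entry_cong: "[p * (w + n * p ^ s) + i = p * w + i] (mod p ^ Suc s)"
proof -
  have "p * (w + n * p ^ s) + i = p * w + i + p ^ Suc s * n"
    by (simp add: algebra_simps)
  then show ?thesis by (simp only: cong_def mod_mult_self2)
qed

text \<open>By \<open>block_entry_cong\<close>, each of the \<open>T\<close> runs of
  \<open>p ^ s\<close> blocks contributes the same constant \<open>prime_fact (p ^ s)\<close>, which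
  will cancel in \<open>ratio_cong\<close>.\<close>

lemma prime_fact_cong: "[prime_fact (M + T * p ^ s) = prime_fact M * prime_fact (p ^ s) ^ T] (mod p ^ Suc s)"
proof -
  have shift: "[prime_fact (T * p ^ s + M) = prime_fact (T * p ^ s) * prime_fact M] (mod p ^ Suc s)" for T M
  proof -
    have "[p * (T * p ^ s + w) + i = p * w + i] (mod p ^ Suc s)" for w i
      using block_entry_cong[of w T s i] by (simp only: add.commute)
    then have "[(\<Prod>w<M. prime_block (T * p ^ s + w)) = prime_fact M] (mod p ^ Suc s)"
      unfolding prime_fact_def prime_block_def by (intro cong_prod) auto
    then show ?thesis unfolding prime_fact_add by (rule cong_scalar_left)
  qed
  have "[prime_fact (T * p ^ s) = prime_fact (p ^ s) ^ T] (mod p ^ Suc s)"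
  proof (induction T)
    case (Suc T)
    have "[prime_fact (T * p ^ s) * prime_fact (p ^ s) = prime_fact (p ^ s) ^ T * prime_fact (p ^ s)] (mod p ^ Suc s)"
      using Suc by (rule cong_scalar_right)
    then show ?case using shift[of T "p ^ s"] by (auto simp: algebra_simps intro: cong_trans)
  qed (simp add: prime_fact_def)
  then have "[prime_fact (T * p ^ s) * prime_fact M = prime_fact (p ^ s) ^ T * prime_fact M] (mod p ^ Suc s)"
    by (rule cong_scalar_right)
  with shift[of T M] show ?thesis by (auto simp: algebra_simps intro: cong_trans)
qed

text \<open>For \<open>v < p\<close>, the quotient by \<open>ratio_den\<close> is the factor
  \<open>multinom\<close> gains when the digit \<open>v\<close> is appended. The product here
  contains multiples of \<open>p\<close> once \<open>N * v \<ge> p\<close>; only the denominator is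
  a unit.\<close>

definition ratio_num :: "nat \<Rightarrow> nat \<Rightarrow> nat \<Rightarrow> nat" where
  "ratio_num N v w = prime_fact (N * w) * (\<Prod>i = 1..N * v. p * (N * w) + i)"

definition ratio_den :: "nat \<Rightarrow> nat \<Rightarrow> nat \<Rightarrow> nat" where
  "ratio_den N v w = (prime_fact w * (\<Prod>i = 1..v. p * w + i)) ^ N"

lemma prime_fact_prod_not_dvd: "v < p \<Longrightarrow> \<not> p dvd prime_fact w * (\<Prod>i = 1..v. p * w + i)"
  using prime_p prime_fact_not_dvd[of w] not_dvd_prod[of "{1..v}" "\<lambda>i. p * w + i"] not_dvd_block[of _ w]
  by (auto simp: prime_dvd_mult_iff)

lemma ratio_den_not_dvd: "v < p \<Longrightarrow> \<not> p dvd ratio_den N v w"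
  unfolding ratio_den_def using prime_p prime_fact_prod_not_dvd prime_dvd_power by blast

lemma fact_digits:
  "v < p \<Longrightarrow> \<exists>c. fact (v + p * w) = p ^ w * fact w * c \<and> \<not> p dvd c"
  using prime_fact_prod_not_dvd[of v w] fact_add_prod[of "p * w" v] fact_p_mult[of w]
  by (intro exI[of _ "prime_fact w * (\<Prod>i = 1..v. p * w + i)"]) (simp add: add.commute mult.assoc)

text \<open>Numerator and denominator carry the same power \<open>p ^ (N * w)\<close>, which
  cancels.\<close>

lemma multinom_step:
  assumes "v < p"
  shows "multinom N (v + p * w) = multinom N w * (of_nat (ratio_num N v w) / of_nat (ratio_den N v w))"
proof -
  define X where "X = (\<Prod>i = 1..N * v. p * (N * w) + i)"
  define Y where "Y = (\<Prod>i = 1..v. p * w + i)"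
  have X: "fact (N * (v + p * w)) = p ^ (N * w) * fact (N * w) * prime_fact (N * w) * X"
    using fact_add_prod[of "p * (N * w)" "N * v"] unfolding X_def fact_p_mult
    by (simp add: algebra_simps)
  have Y: "fact (v + p * w) = p ^ w * fact w * prime_fact w * Y"
    using fact_add_prod[of "p * w" v] unfolding Y_def fact_p_mult by (simp add: algebra_simps)
  have num: "(of_nat (fact (N * (v + p * w))) :: rat)
      = of_nat p ^ (N * w) * (fact (N * w) * of_nat (ratio_num N v w))"
    unfolding X ratio_num_def X_def[symmetric] by simp
  have den: "(of_nat (fact (v + p * w)) ^ N :: rat)
      = of_nat p ^ (N * w) * (fact w ^ N * of_nat (ratio_den N v w))"
    unfolding Y ratio_den_def Y_def[symmetric]
    by (simp only: of_nat_mult of_nat_power of_nat_fact power_mult_distrib mult_ac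
        flip: power_mult)
  have "multinom N (v + p * w) = of_nat (fact (N * (v + p * w))) / of_nat (fact (v + p * w)) ^ N"
    by (simp add: multinom_def)
  also have "\<dots> = multinom N w * (of_nat (ratio_num N v w) / of_nat (ratio_den N v w))"
    unfolding num den multinom_def by (simp only: mult_divide_mult_cancel_left_if times_divide_times_eq) simp
  finally show ?thesis .
qed

text \<open>Shifting \<open>u\<close> by \<open>n * p ^ s\<close> multiplies numerator and
  denominator by the same \<open>W ^ (N * n)\<close>.\<close>

lemma ratio_cong:
  "[ratio_num N v (u + n * p ^ s) * ratio_den N v u
    = ratio_num N v u * ratio_den N v (u + n * p ^ s)] (mod p ^ Suc s)"
proof -
  define W where "W = prime_fact (p ^ s)"
  have Y: "[(\<Prod>i = 1..v. p * (u + n * p ^ s) + i) = (\<Prod>i = 1..v. p * u + i)] (mod p ^ Suc s)"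
    by (intro cong_prod block_entry_cong)
  have "[p * (N * (u + n * p ^ s)) + i = p * (N * u) + i] (mod p ^ Suc s)" for i
    using block_entry_cong[of "N * u" "N * n" s i] by (simp only: distrib_left mult.assoc)
  then have X: "[(\<Prod>i = 1..N * v. p * (N * (u + n * p ^ s)) + i) = (\<Prod>i = 1..N * v. p * (N * u) + i)] (mod p ^ Suc s)"
    by (intro cong_prod)
  have "[prime_fact (N * (u + n * p ^ s)) = prime_fact (N * u) * W ^ (N * n)] (mod p ^ Suc s)"
    using prime_fact_cong[of "N * u" "N * n" s] by (simp add: W_def algebra_simps)
  from cong_mult[OF this X]
  have num: "[ratio_num N v (u + n * p ^ s) = ratio_num N v u * W ^ (N * n)] (mod p ^ Suc s)"
    by (simp add: ratio_num_def algebra_simps)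
  have "[prime_fact (u + n * p ^ s) = prime_fact u * W ^ n] (mod p ^ Suc s)"
    unfolding W_def by (rule prime_fact_cong)
  from cong_pow[OF cong_mult[OF this Y], of N]
  have den: "[ratio_den N v (u + n * p ^ s) = ratio_den N v u * W ^ (N * n)] (mod p ^ Suc s)"
    unfolding ratio_den_def power_mult_distrib mult.commute[of N n] power_mult
    by (simp only: mult_ac)
  have "[ratio_num N v (u + n * p ^ s) * ratio_den N v u
      = ratio_num N v u * W ^ (N * n) * ratio_den N v u] (mod p ^ Suc s)"
    by (rule cong_scalar_right[OF num])
  also have "ratio_num N v u * W ^ (N * n) * ratio_den N v u
      = ratio_num N v u * (ratio_den N v u * W ^ (N * n))"
    by (simp only: mult_ac)
  also have "[\<dots> = ratio_num N v u * ratio_den N v (u + n * p ^ s)] (mod p ^ Suc s)"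
    by (rule cong_scalar_left[OF cong_sym[OF den]])
  finally show ?thesis .
qed

lemma multinom_Zp [simp]: "multinom N m \<in> Zp"
  using multinom_nat[of N m] by auto

lemma multinom_power_dwork: "dwork_sequence p (\<lambda>m. multinom N m ^ k)
    (\<lambda>v w. (of_nat (ratio_num N v w) / of_nat (ratio_den N v w)) ^ k)"
proof
  have ratio_Zp: "of_nat (ratio_num N v w) / of_nat (ratio_den N v w) \<in> Zp" if "v < p" for v w
    using ratio_den_not_dvd[OF that]
    by (intro ZpI[of "int (ratio_den N v w)" _ "int (ratio_num N v w)"]) auto
  fix v u n s w
  assume v: "v < p"
  show "(of_nat (ratio_num N v w) / of_nat (ratio_den N v w)) ^ k \<in> Zp"
    using ratio_Zp[OF v] by blast
  show "multinom N (v + p * w) ^ k = multinom N w ^ k *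
      (of_nat (ratio_num N v w) / of_nat (ratio_den N v w)) ^ k"
    unfolding multinom_step[OF v] by (simp only: power_mult_distrib)
  have "[int (ratio_num N v (u + n * p ^ s)) * int (ratio_den N v u)
    = int (ratio_num N v u) * int (ratio_den N v (u + n * p ^ s))] (mod int p ^ Suc s)"
    using ratio_cong[of N v u n s] unfolding cong_int_iff[symmetric] of_nat_mult of_nat_power .
  from pid_cong_of_int[OF this] ratio_den_not_dvd[OF v]
  show "(of_nat (ratio_num N v (u + n * p ^ s)) / of_nat (ratio_den N v (u + n * p ^ s))) ^ k -
      (of_nat (ratio_num N v u) / of_nat (ratio_den N v u)) ^ k \<in> pid (of_nat p ^ Suc s)"
    by (intro pid_power_diff ratio_Zp v) simp
qed (auto simp: multinom_def[of N 0])

text \<open>The harmonic difference sums the reciprocals of the factors of \<open>X\<close>, and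
  \<open>multinom L ?m\<close> is \<open>X\<close> times a \<open>p\<close>-integral number because
  \<open>Y\<close> is prime to \<open>p\<close>; so each reciprocal is absorbed.
  \<open>L \<le> N\<close> and \<open>k \<ge> 1\<close> make \<open>multinom L ?m\<close> a factor
  of the power.\<close>

lemma multinom_harmonic:
  assumes "a < p" "L \<le> N" "k \<ge> 1"
  shows "multinom N (a + p * j) ^ k * (harmonic (L * (a + p * j)) - harmonic (L * (p * j))) \<in> Zp"
proof -
  let ?m = "a + p * j"
  define X where "X = (\<Prod>i = 1..L * a. L * (p * j) + i)"
  define Y where "Y = (\<Prod>i = 1..a. p * j + i)"
  have Y: "\<not> p dvd Y ^ L"
  proof -
    have "\<not> p dvd Y"
      unfolding Y_def using assms by (intro not_dvd_prod not_dvd_block) auto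
    then show ?thesis using prime_p prime_dvd_power by blast
  qed
  have "fact (L * ?m) = (fact (L * (p * j)) * X :: nat)"
    using fact_add_prod[of "L * (p * j)" "L * a"] by (simp add: X_def algebra_simps)
  then have factX: "fact (L * ?m) = (fact (L * (p * j)) * of_nat X :: rat)"
    by (metis of_nat_fact of_nat_mult)
  have "fact ?m = (fact (p * j) * Y :: nat)"
    using fact_add_prod[of "p * j" a] by (simp add: Y_def algebra_simps)
  then have factY: "fact ?m = (fact (p * j) * of_nat Y :: rat)"
    by (metis of_nat_fact of_nat_mult)
  have eq: "multinom L ?m = of_nat X * (multinom L (p * j) * (1 / of_nat (Y ^ L)))"
    unfolding multinom_def factX factY by (simp add: power_mult_distrib)
  have quot: "multinom L ?m * (1 / of_nat (L * (p * j) + i)) \<in> Zp" if i: "i \<in> {1..L * a}" for i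
  proof -
    have "L * (p * j) + i dvd X"
      unfolding X_def using i by (intro dvd_prodI) auto
    then obtain c where c: "X = (L * (p * j) + i) * c" by auto
    have cancel: "of_nat (n * c) * z * (1 / of_nat n) = of_nat c * z" if "n \<noteq> 0" for n and z :: rat
      using that by simp
    have "multinom L ?m * (1 / of_nat (L * (p * j) + i)) = of_nat c * (multinom L (p * j) * (1 / of_nat (Y ^ L)))"
      unfolding eq c by (rule cancel) (use i in auto)
    also have "\<dots> \<in> Zp"
      by (intro Zp_mult Zp_inverse_of_nat Y) auto
    finally show ?thesis .
  qed
  have "harmonic (L * ?m) - harmonic (L * (p * j)) = (\<Sum>i = 1..L * a. 1 / of_nat (L * (p * j) + i))"
    using harmonic_add[of "L * (p * j)" "L * a"] by (simp add: algebra_simps)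
  then have *: "multinom L ?m * (harmonic (L * ?m) - harmonic (L * (p * j))) \<in> Zp"
    unfolding sum_distrib_left using quot by (simp only: sum_distrib_left) (rule Zp_sum)
  obtain c where "multinom N ?m = multinom L ?m * of_nat c"
    using multinom_dvd[OF assms(2)] by blast
  moreover have "multinom N ?m ^ k = multinom N ?m * multinom N ?m ^ (k - 1)"
    using assms(3) by (simp flip: power_Suc)
  ultimately have "multinom N ?m ^ k * (harmonic (L * ?m) - harmonic (L * (p * j)))
     = of_nat c * multinom N ?m ^ (k - 1) * (multinom L ?m * (harmonic (L * ?m) - harmonic (L * (p * j))))"
    by (simp only: mult_ac)
  also have "\<dots> \<in> Zp"
    by (rule Zp_mult[OF _ *]) (intro Zp_mult Zp_power Zp_of_nat multinom_Zp)
  finally show ?thesis .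
qed

text \<open>In each run of \<open>p\<close> terms only the last denominator is divisible by
  \<open>p\<close>, and \<open>p\<close> times that term is the next term of
  \<open>harmonic J\<close>.\<close>

lemma harmonic_p_mult: "of_nat p * harmonic (J * p) - harmonic J \<in> pid (of_nat p)"
proof (induction J)
  case (Suc J)
  have *: "{1..p} = insert p {1..<p}" using p_nonzero(2) by (auto simp del: p_nonzero)
  have "harmonic (Suc J * p) = harmonic (J * p) + (\<Sum>i = 1..p. 1 / of_nat (J * p + i))"
    using harmonic_add[of "J * p" p] by (simp add: add.commute)
  also have "(\<Sum>i = 1..p. 1 / of_nat (J * p + i) :: rat)
     = (\<Sum>i = 1..<p. 1 / of_nat (J * p + i)) + 1 / of_nat (J * p + p)"
    unfolding * by simp
  also have "1 / of_nat (J * p + p) = (1 / (of_nat p * of_nat (Suc J)) :: rat)"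
    by (simp add: algebra_simps)
  finally have "of_nat p * harmonic (Suc J * p) = of_nat p * harmonic (J * p)
      + of_nat p * (\<Sum>i = 1..<p. 1 / of_nat (J * p + i)) + 1 / of_nat (Suc J)"
    by (simp only: distrib_left) simp
  moreover have "harmonic (Suc J) = harmonic J + 1 / of_nat (Suc J)"
    by (simp add: harmonic_def)
  ultimately have "of_nat p * harmonic (Suc J * p) - harmonic (Suc J)
    = (of_nat p * harmonic (J * p) - harmonic J) + of_nat p * (\<Sum>i = 1..<p. 1 / of_nat (J * p + i))"
    by (simp only:)
  also have "\<dots> \<in> pid (of_nat p)"
    using not_dvd_block[of _ J]
    by (intro pid_add Suc pid_mult_right pid_self Zp_sum Zp_inverse_of_nat) (auto simp: mult.commute)
  finally show ?case .
qed (simp add: harmonic_def)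

lemma harmonic_p_power_mult: "of_nat p ^ s * harmonic (x * p ^ s) - harmonic x \<in> Zp"
proof (induction s)
  case (Suc s)
  have "of_nat p ^ s * (of_nat p * harmonic ((x * p ^ s) * p) - harmonic (x * p ^ s)) \<in> Zp"
    using pid_p_Zp[OF harmonic_p_mult] by (intro Zp_mult Zp_power) auto
  from Zp_add[OF this Suc] show ?case by (simp add: algebra_simps)
qed auto

end

subsection \<open>Congruences with harmonic numbers\<close>

text \<open>The hypothesis asks \<open>A\<close> to absorb the denominators at \<open>p\<close> that
  appear when the last digit is appended.\<close>

locale dwork_harmonic = dwork_sequence +
  fixes L :: nat
  assumes A_harmonic: "a < p \<Longrightarrow>
    A (a + p * j) * (harmonic (L * (a + p * j)) - harmonic (L * (p * j))) \<in> Zp"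
begin

text \<open>By \<open>harmonic_p_power_mult\<close>, the factor \<open>p ^ s\<close> undoes the
  scaling of both arguments up to integral errors, which leaves \<open>A_harmonic\<close>.\<close>

lemma A_harmonic_power:
  assumes "a < p"
  shows "of_nat p ^ s * A (a + p * j)
    * (harmonic (L * ((a + p * j) * p ^ s)) - harmonic (L * (j * p ^ Suc s))) \<in> Zp"
proof -
  let ?e = "\<lambda>x. of_nat p ^ s * harmonic (x * p ^ s) - harmonic x"
  have "A (a + p * j) * ?e (L * (a + p * j)) - A (a + p * j) * ?e (L * (p * j))
    + A (a + p * j) * (harmonic (L * (a + p * j)) - harmonic (L * (p * j))) \<in> Zp"
    by (intro Zp_add Zp_diff Zp_mult A_Zp harmonic_p_power_mult A_harmonic assms)
  then show ?thesis by (simp add: algebra_simps)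
qed

text \<open>Moving the base point from the left end of a subblock to that of the block costs a
  harmonic increment times \<open>U\<close>. Of the divisor in \<open>dwork_congruence\<close>, all
  but one \<open>p\<close> goes into making the increment integral.\<close>

lemma harmonic_block:
  assumes a: "a < p"
  shows "(\<Sum>j\<in>{m * p ^ s..<(m + 1) * p ^ s}. (harmonic (L * j) - harmonic (L * (m * p ^ s))) * D a K j)
    \<in> pid (of_nat p)"
proof (induction s arbitrary: m)
  case (Suc s)
  let ?h = "\<lambda>j. (harmonic (L * j) - harmonic (L * (m * p ^ Suc s))) * D a K j"
  have inner: "sum ?h {(p * m + i) * p ^ s..<(p * m + i + 1) * p ^ s} \<in> pid (of_nat p)" if i: "i < p" for i
  proof -
    let ?n = "p * m + i"
    have "sum ?h {?n * p ^ s..<(?n + 1) * p ^ s}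
      = (\<Sum>j\<in>{?n * p ^ s..<(?n + 1) * p ^ s}. (harmonic (L * j) - harmonic (L * (?n * p ^ s))) * D a K j)
        + (harmonic (L * (?n * p ^ s)) - harmonic (L * (m * p ^ Suc s))) * U a K s ?n"
      unfolding U_def sum_distrib_left sum.distrib[symmetric]
      by (intro sum.cong) (simp_all add: algebra_simps)
    moreover have "(harmonic (L * (?n * p ^ s)) - harmonic (L * (m * p ^ Suc s))) * U a K s ?n
        \<in> pid (of_nat p)"
    proof -
      obtain y where y: "y \<in> Zp" "U a K s ?n = of_nat p ^ Suc s * A ?n * y"
        using dwork_congruence[OF a, of K s ?n] by (auto simp: pid_def)
      have "(harmonic (L * (?n * p ^ s)) - harmonic (L * (m * p ^ Suc s))) * U a K s ?n
        = of_nat p * (of_nat p ^ s * A ?n * (harmonic (L * (?n * p ^ s)) - harmonic (L * (m * p ^ Suc s))) * y)"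
        unfolding y by (simp add: mult_ac)
      also have "\<dots> \<in> pid (of_nat p)"
        using A_harmonic_power[OF i, of s m]
        by (intro pid_mult_right pid_self Zp_mult[OF _ y(1)]) (simp only: add.commute)
      finally show ?thesis .
    qed
    ultimately show ?thesis using Suc.IH[of ?n] by auto
  qed
  have "(\<Sum>i<p. sum ?h {(p * m + i) * p ^ s..<(p * m + i + 1) * p ^ s}) \<in> pid (of_nat p)"
    by (rule pid_sum, rule inner) simp
  then show ?case
    unfolding sum_blocks by (simp add: algebra_simps)
qed simp

text \<open>These are the coefficients of \<open>F(z) G(z^p) - p G(z) F(z^p)\<close> in degree
  \<open>a + p * K\<close>. Replacing \<open>p * harmonic (L * (a + p * j))\<close> by
  \<open>harmonic (L * j)\<close> turns the sum into one block of \<open>harmonic_block\<close>;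
  \<open>?r\<close> is the error.\<close>

theorem harmonic_congruence:
  assumes a: "a < p"
  shows "(\<Sum>j\<le>K. A (a + p * (K - j)) * (A j * harmonic (L * j))
    - of_nat p * (A (K - j) * (A (a + p * j) * harmonic (L * (a + p * j))))) \<in> pid (of_nat p)"
proof -
  let ?h = "\<lambda>j. harmonic (L * j) * D a K j"
  let ?r = "\<lambda>j. of_nat p * harmonic (L * (a + p * j)) - harmonic (L * j)"
  \<comment> \<open>The block of level \<open>K\<close> starting at 0 covers all
    \<open>j \<le> K\<close>, and \<open>harmonic 0 = 0\<close> at its left end.\<close>
  have "K < p ^ K"
    using prime_gt_1_nat[OF prime_p] by (intro power_gt_expt) simp
  then have "sum ?h {0..<p ^ K} = sum ?h {..K}"
    by (intro sum.mono_neutral_right) (auto simp: D_def)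
  moreover have "sum ?h {0..<p ^ K} \<in> pid (of_nat p)"
    using harmonic_block[OF a, of 0 K K] by (simp add: harmonic_def)
  moreover have "(\<Sum>j\<le>K. A (K - j) * (A (a + p * j) * ?r j)) \<in> pid (of_nat p)"
  proof (intro pid_sum)
    fix j
    have "A (a + p * j) * ?r j
      = A (a + p * j) * (of_nat p * harmonic ((L * j) * p) - harmonic (L * j))
      + of_nat p * (A (a + p * j) * (harmonic (L * (a + p * j)) - harmonic (L * (p * j))))"
      by (simp add: algebra_simps)
    also have "\<dots> \<in> pid (of_nat p)"
      by (intro pid_add pid_mult_left[OF A_Zp] pid_mult_right[OF pid_self] harmonic_p_mult A_harmonic a)
    finally show "A (K - j) * (A (a + p * j) * ?r j) \<in> pid (of_nat p)"
      by (rule pid_mult_left[OF A_Zp])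
  qed
  ultimately have "sum ?h {..K} - (\<Sum>j\<le>K. A (K - j) * (A (a + p * j) * ?r j)) \<in> pid (of_nat p)"
    by auto
  also have "sum ?h {..K} - (\<Sum>j\<le>K. A (K - j) * (A (a + p * j) * ?r j))
    = (\<Sum>j\<le>K. A (a + p * (K - j)) * (A j * harmonic (L * j))
    - of_nat p * (A (K - j) * (A (a + p * j) * harmonic (L * (a + p * j)))))"
    unfolding sum_subtractf[symmetric] by (intro sum.cong) (auto simp: D_def algebra_simps)
  finally show ?thesis .
qed

end

subsection \<open>Dwork's exponential lemma\<close>

text \<open>In characteristic 0 the equation determines each coefficient from the earlier ones, so
  series can be compared through logarithmic derivatives.\<close>

lemma fps_linear_ode_unique:
  fixes y z g :: "'a :: field_char_0 fps"
  assumes "fps_deriv y = g * y" "fps_deriv z = g * z" "fps_nth y 0 = fps_nth z 0"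
  shows "y = z"
proof (rule fps_ext)
  fix n
  show "fps_nth y n = fps_nth z n"
  proof (induction n rule: less_induct)
    case (less n)
    show ?case
    proof (cases n)
      case (Suc m)
      have "fps_nth (fps_deriv y) m = fps_nth (fps_deriv z) m"
        unfolding assms fps_mult_nth using less Suc by (intro sum.cong) auto
      then have "of_nat n * fps_nth y n = of_nat n * fps_nth z n"
        by (simp add: Suc del: of_nat_Suc)
      then show ?thesis using Suc by (simp del: of_nat_Suc)
    qed (simp add: assms)
  qed
qed

text \<open>First-order expansion; since \<open>h\<close> has constant term 1 and
  \<open>n > 0\<close>, the other terms do not affect the constant term of \<open>r\<close>.\<close>

lemma fps_power_truncate:
  fixes q h t :: "'a :: comm_ring_1 fps"
  assumes q: "q = h + fps_X ^ n * t" and h0: "fps_nth h 0 = 1" and n: "n > 0"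
  shows "\<exists>r. q ^ m = h ^ m + fps_X ^ n * r \<and> fps_nth r 0 = of_nat m * fps_nth t 0"
proof (induction m)
  case 0
  show ?case by (intro exI[of _ 0]) simp
next
  case (Suc m)
  then obtain r where r: "q ^ m = h ^ m + fps_X ^ n * r" "fps_nth r 0 = of_nat m * fps_nth t 0"
    by blast
  have "q ^ Suc m = (h + fps_X ^ n * t) * (h ^ m + fps_X ^ n * r)"
    unfolding power_Suc r(1) by (subst q) simp
  also have "\<dots> = h ^ Suc m + fps_X ^ n * (t * h ^ m + h * r + fps_X ^ n * t * r)"
    by (simp add: algebra_simps)
  finally show ?case
    by (intro exI[of _ "t * h ^ m + h * r + fps_X ^ n * t * r"] conjI)
      (use r(2) h0 n in \<open>simp_all add: fps_power_zeroth_eq_one algebra_simps\<close>)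
qed

lemma fps_compose_X_power_mult_nth:
  fixes f g :: "'a :: comm_ring_1 fps"
  assumes "a < d"
  shows "fps_nth (f * (g oo fps_X ^ d)) (a + d * K) = (\<Sum>j\<le>K. fps_nth f (a + d * (K - j)) * fps_nth g j)"
proof -
  let ?F = "\<lambda>i. fps_nth (g oo fps_X ^ d) i * fps_nth f (a + d * K - i)"
  \<comment> \<open>As \<open>a < d\<close>, the cutoff falls exactly at
    \<open>j = K\<close>.\<close>
  have *: "d * j \<le> a + d * K \<longleftrightarrow> j \<le> K" for j
  proof
    assume "d * j \<le> a + d * K"
    then have "d * j < d * Suc K" using assms by simp
    then show "j \<le> K" by (simp only: mult_less_cancel1 less_Suc_eq_le)
  qed (simp add: trans_le_add2)
  have "fps_nth (f * (g oo fps_X ^ d)) (a + d * K) = sum ?F {0..a + d * K}"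
    by (simp add: mult.commute[of f] fps_mult_nth)
  also have "\<dots> = sum ?F ((\<lambda>j. d * j) ` {..K})"
    by (rule sum.mono_neutral_right) (auto simp: fps_nth_compose_X_power * elim!: dvdE)
  also have "\<dots> = (\<Sum>j\<le>K. ?F (d * j))"
    using assms by (subst sum.reindex) (auto simp: inj_on_def)
  also have "\<dots> = (\<Sum>j\<le>K. fps_nth f (a + d * (K - j)) * fps_nth g j)"
    using assms by (intro sum.cong) (auto simp: fps_nth_compose_X_power diff_mult_distrib2 mult.commute)
  finally show ?thesis .
qed

section \<open>Power series with coefficients in a fractional ideal\<close>

context padic
begin

definition fps_pid :: "rat \<Rightarrow> rat fps set" where
  "fps_pid c = {f. \<forall>n. fps_nth f n \<in> pid c}"

lemma fps_pidD: "f \<in> fps_pid c \<Longrightarrow> fps_nth f n \<in> pid c"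
  by (simp add: fps_pid_def)

lemma fps_pid_add: "f \<in> fps_pid c \<Longrightarrow> g \<in> fps_pid c \<Longrightarrow> f + g \<in> fps_pid c"
  and fps_pid_diff: "f \<in> fps_pid c \<Longrightarrow> g \<in> fps_pid c \<Longrightarrow> f - g \<in> fps_pid c"
  by (auto simp: fps_pid_def)

lemma fps_pid_0: "0 \<in> fps_pid c"
  by (simp add: fps_pid_def)

lemma fps_pid_sum: "(\<And>i. i \<in> I \<Longrightarrow> f i \<in> fps_pid c) \<Longrightarrow> sum f I \<in> fps_pid c"
  by (induction I rule: infinite_finite_induct) (auto simp: fps_pid_add fps_pid_0)

lemma fps_pid_mult: "f \<in> fps_pid c \<Longrightarrow> g \<in> fps_pid d \<Longrightarrow> f * g \<in> fps_pid (c * d)"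
  by (auto simp: fps_pid_def fps_mult_nth intro!: pid_sum pid_mult)

lemma fps_pid_const: "c \<in> pid d \<Longrightarrow> fps_const c \<in> fps_pid d"
  by (auto simp: fps_pid_def)

lemma fps_pid_1_mult: "f \<in> fps_pid 1 \<Longrightarrow> g \<in> fps_pid 1 \<Longrightarrow> f * g \<in> fps_pid 1"
  using fps_pid_mult[of f 1 g 1] by simp

lemma fps_pid_1_power: "f \<in> fps_pid 1 \<Longrightarrow> f ^ n \<in> fps_pid 1"
proof (induction n)
  case (Suc n)
  then show ?case unfolding power_Suc by (intro fps_pid_1_mult)
qed (simp add: fps_pid_def)

lemma fps_pid_inverse:
  assumes "f \<in> fps_pid 1" "fps_nth f 0 = 1"
  shows "inverse f \<in> fps_pid 1"
proof -
  have "fps_nth (inverse f) n \<in> Zp" for n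
  proof (induction n rule: less_induct)
    case (less n)
    show ?case
    proof (cases "n = 0")
      case False
      have "0 = fps_nth (f * inverse f) n"
        using False assms(2) by (simp add: inverse_mult_eq_1')
      also have "\<dots> = fps_nth (inverse f) n + (\<Sum>i=1..n. fps_nth f i * fps_nth (inverse f) (n - i))"
        unfolding fps_mult_nth using assms(2) by (simp add: sum.atLeast_Suc_atMost)
      finally have "fps_nth (inverse f) n = - (\<Sum>i=1..n. fps_nth f i * fps_nth (inverse f) (n - i))"
        by (simp add: eq_neg_iff_add_eq_0)
      also have "\<dots> \<in> Zp"
        using less assms(1) by (intro Zp_uminus Zp_sum Zp_mult) (auto simp: fps_pid_def)
      finally show ?thesis .
    qed (simp add: assms)
  qed
  then show ?thesis by (simp add: fps_pid_def)
qed

lemma fps_pid_compose_X_power: "f \<in> fps_pid c \<Longrightarrow> f oo fps_X ^ d \<in> fps_pid c"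
  by (auto simp: fps_pid_def fps_nth_compose_X_power)

lemma of_nat_dvd_pid: "p dvd n \<Longrightarrow> of_nat n \<in> pid (of_nat p)"
  by (elim dvdE) (simp add: pid_mult_right)

text \<open>The residue field is that of the integers: the denominator is replaced by its inverse
  modulo \<open>p\<close>.\<close>

lemma Zp_approx_nat:
  assumes "x \<in> Zp"
  shows "\<exists>n::nat. x - of_nat n \<in> pid (of_nat p)"
proof -
  obtain a b where ab: "\<not> int p dvd b" "x = of_int a / of_int b"
    using assms by (auto simp: Zp_def)
  have "coprime b (int p)"
    using ab(1) prime_int_p by (metis prime_imp_coprime coprime_commute)
  then obtain c where c: "[b * c = 1] (mod int p)"
    using cong_solve_coprime_int by blast
  define n where "n = nat (a * c mod int p)"
  have n: "int n = a * c mod int p" by (simp add: n_def)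
  have "[int n * b = a * c * b] (mod int p)"
    unfolding n by (intro cong_mult) auto
  also have "[a * c * b = a * 1] (mod int p)"
    using cong_scalar_left[OF c, of a] by (simp add: mult_ac)
  finally have "[a * 1 = int n * b] (mod int p ^ 1)"
    by (simp add: cong_sym)
  moreover have "\<not> int p dvd 1"
    using prime_int_p not_prime_unit by blast
  ultimately have "of_int a / of_int b - of_int (int n) / of_int 1 \<in> pid (of_nat p ^ 1)"
    using ab(1) by (intro pid_cong_of_int)
  then show ?thesis using ab(2) by auto
qed

lemma Zp_fermat:
  assumes "x \<in> Zp"
  shows "x ^ p - x \<in> pid (of_nat p)"
proof -
  obtain n where n: "x - of_nat n \<in> pid (of_nat p)"
    using Zp_approx_nat[OF assms] by blast
  have "[n ^ p = n] (mod p)"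
  proof (cases "p dvd n")
    case True
    then have "p dvd n ^ p" using p_nonzero(2) by (meson dvd_power dvd_trans)
    with True show ?thesis by (simp add: cong_def)
  next
    case False
    have "n ^ p = n ^ (p - 1) * n" using p_nonzero(2) by (simp flip: power_Suc2)
    then show ?thesis
      using cong_scalar_right[OF fermat_theorem[OF prime_p False], of n] by simp
  qed
  then have "int p dvd int n ^ p - int n"
    by (simp add: cong_iff_dvd_diff flip: cong_int_iff)
  then obtain c where "int n ^ p - int n = int p * c" by blast
  then have "of_int (int n ^ p - int n) = (of_nat p * of_int c :: rat)" by simp
  then have "of_nat n ^ p - of_nat n \<in> pid (of_nat p)"
    by (intro pidI[of "of_int c"]) auto
  moreover have "x ^ p - of_nat n ^ p \<in> pid (of_nat p)"
    using n assms by (intro pid_power_diff) auto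
  ultimately have "(x ^ p - of_nat n ^ p) + (of_nat n ^ p - of_nat n) - (x - of_nat n) \<in> pid (of_nat p)"
    using n pid_add pid_diff by blast
  then show ?thesis by simp
qed

lemma fps_power_p_add:
  assumes "f \<in> fps_pid 1" "g \<in> fps_pid 1"
  shows "(f + g) ^ p - (f ^ p + g ^ p) \<in> fps_pid (of_nat p)"
proof -
  let ?t = "\<lambda>k. of_nat (p choose k) * f ^ k * g ^ (p - k)"
  have "{..p} = insert 0 (insert p {0<..<p})" by auto
  then have "(f + g) ^ p - (f ^ p + g ^ p) = sum ?t {0<..<p}"
    unfolding binomial_ring by simp
  also have "\<dots> \<in> fps_pid (of_nat p)"
  proof (rule fps_pid_sum)
    fix k assume k: "k \<in> {0<..<p}"
    have "fps_const (of_nat (p choose k)) * (f ^ k * g ^ (p - k)) \<in> fps_pid (of_nat p * 1)"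
      using k by (intro fps_pid_mult fps_pid_const of_nat_dvd_pid dvd_choose_prime prime_p
          fps_pid_1_mult fps_pid_1_power assms) auto
    then show "?t k \<in> fps_pid (of_nat p)" by (simp add: fps_of_nat mult.assoc)
  qed
  finally show ?thesis .
qed

text \<open>Frobenius modulo \<open>p\<close>, one monomial at a time, with \<open>Zp_fermat\<close>
  for its coefficient. Assuming integrality only below \<open>n\<close> fits the strong induction in
  \<open>fps_exp_compose_integral\<close>.\<close>

lemma fps_cutoff_power_p:
  assumes "\<And>i. i < n \<Longrightarrow> fps_nth f i \<in> Zp"
  shows "fps_cutoff n f ^ p - (fps_cutoff n f oo fps_X ^ p) \<in> fps_pid (of_nat p)"
  using assms
proof (induction n)
  case (Suc n)
  let ?h = "fps_cutoff n f" and ?m = "fps_const (fps_nth f n) * fps_X ^ n"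
  have split: "fps_cutoff (Suc n) f = ?h + ?m"
    by (rule fps_ext) (auto simp: less_Suc_eq)
  have fn: "fps_nth f n \<in> Zp" using Suc.prems by simp
  have "?h \<in> fps_pid 1"
    using Suc.prems by (auto simp: fps_pid_def)
  moreover have "?m \<in> fps_pid 1"
    using fn by (auto simp: fps_pid_def)
  ultimately have "(?h + ?m) ^ p - (?h ^ p + ?m ^ p) \<in> fps_pid (of_nat p)"
    by (rule fps_power_p_add)
  moreover have "?m ^ p - (?m oo fps_X ^ p) \<in> fps_pid (of_nat p)"
  proof -
    have "?m oo fps_X ^ p = fps_const (fps_nth f n) * fps_X ^ (p * n)"
      by (rule fps_ext) (auto simp: fps_nth_compose_X_power)
    then have "?m ^ p - (?m oo fps_X ^ p) = fps_const (fps_nth f n ^ p - fps_nth f n) * fps_X ^ (p * n)"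
      by (simp add: power_mult_distrib fps_const_power left_diff_distrib mult.commute[of p n]
          flip: power_mult fps_const_sub)
    also have "\<dots> \<in> fps_pid (of_nat p)"
      using Zp_fermat[OF fn] by (auto simp: fps_pid_def)
    finally show ?thesis .
  qed
  moreover have "?h ^ p - (?h oo fps_X ^ p) \<in> fps_pid (of_nat p)"
    using Suc by auto
  ultimately have "((?h + ?m) ^ p - (?h ^ p + ?m ^ p)) + (?m ^ p - (?m oo fps_X ^ p))
     + (?h ^ p - (?h oo fps_X ^ p)) \<in> fps_pid (of_nat p)"
    by (intro fps_pid_add)
  then show ?case
    unfolding split fps_compose_add_distrib by (simp add: algebra_simps)
qed (simp add: fps_pid_0 power_0_left)

text \<open>Up to a unit, \<open>fact n\<close> is \<open>p ^ w * fact w\<close> with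
  \<open>w = n div p\<close>. As \<open>2 * w \<le> n\<close>, the factor
  \<open>p ^ w / fact w\<close> splits off and the induction applies; for \<open>w = 0\<close> the
  factorial is a unit.\<close>

lemma p_power_div_fact: "n > 0 \<Longrightarrow> of_nat p ^ n / fact n \<in> pid (of_nat p)"
proof (induction n rule: less_induct)
  case (less n)
  define w where "w = n div p"
  define v where "v = n mod p"
  have n: "n = v + p * w" by (simp add: v_def w_def)
  obtain c where c: "fact n = p ^ w * fact w * c" "\<not> p dvd c"
    using fact_digits[of v w, folded n] by (auto simp: v_def)
  have factn: "(fact n :: rat) = of_nat p ^ w * fact w * of_nat c"
    using arg_cong[OF c(1), of "of_nat :: _ \<Rightarrow> rat"] by simp
  have c': "1 / of_nat c \<in> Zp" using c(2) by (rule Zp_inverse_of_nat)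
  show ?case
  proof (cases "w = 0")
    case True
    have "(of_nat p ^ n / fact n :: rat) = of_nat p * (of_nat p ^ (n - 1) * (1 / of_nat c))"
      unfolding factn using True less.prems by (simp flip: power_Suc)
    then show ?thesis using c' by (intro pidI[OF Zp_mult[OF Zp_power[OF Zp_of_nat]]])
  next
    case False
    have "2 * w \<le> p * w" using prime_ge_2_nat[OF prime_p] by (rule mult_le_mono1)
    then have w: "2 * w \<le> n" "w < n" using n False by linarith+
    have "of_nat p ^ n = (of_nat p ^ w * of_nat p ^ w * of_nat p ^ (n - 2 * w) :: rat)"
      using w by (simp flip: power_add)
    then have "(of_nat p ^ n / fact n :: rat) = of_nat p ^ w / fact w * (of_nat p ^ (n - 2 * w) * (1 / of_nat c))"
      unfolding factn by simp
    also have "\<dots> \<in> pid (of_nat p)"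
      using less.IH[OF w(2)] False c' by (intro pid_mult_right Zp_mult Zp_power Zp_of_nat) auto
    finally show ?thesis .
  qed
qed

lemma fps_exp_p_compose_nth:
  assumes "T \<in> fps_pid 1" "n > 0"
  shows "fps_nth (fps_exp (of_nat p) oo T) n \<in> pid (of_nat p)"
  unfolding fps_compose_nth
proof (rule pid_sum)
  fix i assume "i \<in> {0..n}"
  show "fps_nth (fps_exp (of_nat p)) i * fps_nth (T ^ i) n \<in> pid (of_nat p)"
  proof (cases "i = 0")
    case False
    then show ?thesis
      using p_power_div_fact[of i] fps_pidD[OF fps_pid_1_power[OF assms(1)], of i n]
      by (intro pid_mult_right) auto
  qed (use assms in simp)
qed

text \<open>\<open>q = exp S\<close> satisfies \<open>q\<^sup>p = q(z\<^sup>p) exp (p T)\<close>. The truncation \<open>h\<close> of \<open>q\<close> below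
  degree \<open>n\<close> satisfies \<open>h\<^sup>p \<equiv> h(z\<^sup>p)\<close> modulo \<open>p\<close>, so comparing coefficients of \<open>z\<^sup>n\<close> shows
  that \<open>p q\<^sub>n\<close> is divisible by \<open>p\<close>.\<close>

theorem fps_exp_compose_integral:
  fixes S T :: "rat fps"
  assumes S0: "fps_nth S 0 = 0" and T0: "fps_nth T 0 = 0" and T: "T \<in> fps_pid 1"
    and ST: "fps_const (of_nat p) * S - (S oo fps_X ^ p) = fps_const (of_nat p) * T"
  shows "fps_exp 1 oo S \<in> fps_pid 1"
proof -
  define q where "q = fps_exp 1 oo S"
  define Q where "Q = q oo fps_X ^ p"
  define E where "E = fps_exp (of_nat p) oo T"
  have q0: "fps_nth q 0 = 1" and Q0: "fps_nth Q 0 = 1" and E0: "fps_nth E 0 = 1"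
    by (simp_all add: q_def Q_def E_def)
  have Q: "Q = fps_exp 1 oo (S oo fps_X ^ p)"
    unfolding Q_def q_def using S0 by (intro fps_compose_assoc[symmetric]) auto
  have dq: "fps_deriv q = fps_deriv S * q"
    unfolding q_def by (simp add: fps_compose_deriv S0)
  have dQ: "fps_deriv Q = fps_deriv (S oo fps_X ^ p) * Q"
    unfolding Q by (subst fps_compose_deriv) (simp_all add: S0)
  have dE: "fps_deriv E = fps_const (of_nat p) * fps_deriv T * E"
    unfolding E_def by (simp add: fps_compose_deriv T0 fps_compose_mult_distrib)
  have "S oo fps_X ^ p = fps_const (of_nat p) * S - fps_const (of_nat p) * T"
    using ST by (simp add: algebra_simps)
  then have dS: "fps_deriv (S oo fps_X ^ p) = fps_const (of_nat p) * fps_deriv S - fps_const (of_nat p) * fps_deriv T"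
    by simp
  \<comment> \<open>Both sides have logarithmic derivative \<open>p S'\<close> and constant term
    1.\<close>
  have qp: "q ^ p = Q * E"
  proof (rule fps_linear_ode_unique)
    have "fps_deriv (q ^ p) = fps_const (of_nat p) * fps_deriv S * (q * q ^ (p - 1))"
      unfolding fps_deriv_power dq by (simp add: mult_ac)
    then show "fps_deriv (q ^ p) = fps_const (of_nat p) * fps_deriv S * q ^ p"
      using p_nonzero(2) by (simp flip: power_Suc)
    show "fps_deriv (Q * E) = fps_const (of_nat p) * fps_deriv S * (Q * E)"
      unfolding fps_deriv_mult dQ dE dS by (simp add: algebra_simps)
    show "fps_nth (q ^ p) 0 = fps_nth (Q * E) 0"
      using q0 Q0 E0 by (simp add: fps_power_zeroth)
  qed
  have "fps_nth q n \<in> Zp" for n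
  proof (induction n rule: less_induct)
    case (less n)
    show ?case
    proof (cases "n = 0")
      case False
      let ?h = "fps_cutoff n q"
      have "q = ?h + fps_X ^ n * fps_shift n q"
        using fps_shift_cutoff'[of n q] by (simp add: add.commute)
      from fps_power_truncate[OF this, of p] obtain r where
        r: "q ^ p = ?h ^ p + fps_X ^ n * r" "fps_nth r 0 = of_nat p * fps_nth q n"
        using False q0 by auto
      have "fps_nth (q ^ p) n = fps_nth (?h ^ p) n + of_nat p * fps_nth q n"
        unfolding r(1) by (simp add: r(2) fps_X_power_mult_nth)
      moreover have h: "fps_nth (?h ^ p) n - fps_nth (?h oo fps_X ^ p) n \<in> pid (of_nat p)"
        using fps_pidD[OF fps_cutoff_power_p[of n q, OF less.IH], of n] by simp
      \<comment> \<open>Degree \<open>n\<close> of a series in \<open>z^p\<close> involves at most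
        degree \<open>n div p < n\<close>, which the cutoff keeps.\<close>
      moreover have "fps_nth (?h oo fps_X ^ p) n = fps_nth Q n"
        using False prime_gt_1_nat[OF prime_p] by (auto simp: Q_def fps_nth_compose_X_power)
      moreover have qQ: "fps_nth (q ^ p) n - fps_nth Q n \<in> pid (of_nat p)"
      proof -
        have "fps_nth (q ^ p) n = (\<Sum>i=0..<n. fps_nth Q i * fps_nth E (n - i)) + fps_nth Q n"
          unfolding qp fps_mult_nth using E0 by (simp flip: atLeastLessThanSuc_atLeastAtMost)
        moreover have "fps_nth Q i * fps_nth E (n - i) \<in> pid (of_nat p)" if "i < n" for i
        proof (rule pid_mult_left)
          have "i div p < n" using that div_le_dividend[of i p] by linarith
          then show "fps_nth Q i \<in> Zp"
            using less.IH by (auto simp: Q_def fps_nth_compose_X_power)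
          show "fps_nth E (n - i) \<in> pid (of_nat p)"
            unfolding E_def using T that by (intro fps_exp_p_compose_nth) auto
        qed
        ultimately show ?thesis by auto
      qed
      \<comment> \<open>In degree \<open>n\<close> both \<open>q ^ p\<close> and
        \<open>?h ^ p\<close> are congruent to \<open>Q\<close>, and they differ by \<open>p\<close>
        times the coefficient of \<open>q\<close>.\<close>
      ultimately have "of_nat p * fps_nth q n \<in> pid (of_nat p)"
        using pid_diff[OF qQ h] by simp
      then show ?thesis by (subst (asm) pid_cancel1) auto
    qed (simp add: q0)
  qed
  then show ?thesis by (simp add: fps_pid_def q_def)
qed

end

subsection \<open>Integrality of the mirror map\<close>

text \<open>A prime dividing the reduced denominator would also divide the numerator.\<close>

lemma rat_integral_at_all_primes:
  assumes "\<And>p. prime p \<Longrightarrow> x \<in> padic.Zp p"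
  shows "x \<in> \<int>"
proof -
  obtain a b where ab: "quotient_of x = (a, b)" by (cases "quotient_of x")
  have b: "b > 0" "coprime a b" and x: "x = of_int a / of_int b"
    using quotient_of_denom_pos[OF ab] quotient_of_coprime[OF ab] quotient_of_div[OF ab] by auto
  have "nat b = 1"
  proof (rule ccontr)
    assume "nat b \<noteq> 1"
    then obtain p where p: "prime p" "p dvd nat b" using prime_factor_nat by blast
    interpret padic p using p(1) by unfold_locales
    obtain c d where cd: "\<not> int p dvd d" "x = of_int c / of_int d"
      using assms[OF p(1)] by (auto simp: Zp_def)
    have "d \<noteq> 0" using cd by auto
    then have "(of_int (a * d) :: rat) = of_int (c * b)"
      using x cd b by (simp add: field_simps)
    then have "a * d = c * b" by (simp only: of_int_eq_iff)
    moreover have pb: "int p dvd b"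
      using p(2) b(1) by (metis int_dvd_int_iff int_nat_eq less_imp_le)
    ultimately have "int p dvd a"
      using cd(1) prime_int_p by (metis dvd_mult prime_dvd_mult_iff)
    then show False
      using pb b(2) prime_int_p by (meson coprime_common_divisor not_prime_unit)
  qed
  then have "b = 1" using b(1) by linarith
  then show ?thesis using x by simp
qed

context dwork_harmonic
begin

theorem fps_exp_ratio_integral:
  defines "F \<equiv> Abs_fps A" and "G \<equiv> Abs_fps (\<lambda>m. A m * harmonic (L * m))"
  shows "fps_exp 1 oo (G / F) \<in> fps_pid 1"
proof -
  define S where "S = G / F"
  define F' where "F' = F oo fps_X ^ p"
  have F: "F \<in> fps_pid 1" "fps_nth F 0 = 1" and G0: "fps_nth G 0 = 0"
    using A_Zp A_0 by (auto simp: fps_pid_def F_def G_def harmonic_def)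
  have F': "F' \<in> fps_pid 1" "fps_nth F' 0 = 1"
    unfolding F'_def using F by (auto intro: fps_pid_compose_X_power)
  have invF: "F * inverse F = 1" and invF': "F' * inverse F' = 1"
    using F F' by (auto intro: inverse_mult_eq_1')
  have S: "S = G * inverse F"
    unfolding S_def using F by (intro fps_divide_unit) auto
  have GF: "G = S * F" using invF by (simp add: S mult_ac)
  have S0: "fps_nth S 0 = 0" by (simp add: S G0)
  have GF': "G oo fps_X ^ p = (S oo fps_X ^ p) * F'"
    unfolding F'_def by (subst GF, rule fps_compose_mult_distrib) simp
  \<comment> \<open>This is \<open>p S - S(z^p)\<close> multiplied by \<open>- F * F'\<close>; its
    coefficients are the sums of \<open>harmonic_congruence\<close>.\<close>
  define M where "M = F * (G oo fps_X ^ p) - fps_const (of_nat p) * (G * F')"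
  have "fps_nth M n \<in> pid (of_nat p)" for n
  proof -
    define a where "a = n mod p"
    define K where "K = n div p"
    have a: "a < p" and n: "n = a + p * K" by (auto simp: a_def K_def)
    have "(\<Sum>j\<le>K. fps_nth G (a + p * (K - j)) * fps_nth F j)
        = (\<Sum>j\<le>K. fps_nth G (a + p * j) * fps_nth F (K - j))"
      by (rule sum.reindex_bij_witness[of _ "\<lambda>j. K - j" "\<lambda>j. K - j"]) auto
    then have "fps_nth M n = (\<Sum>j\<le>K. A (a + p * (K - j)) * (A j * harmonic (L * j))
      - of_nat p * (A (K - j) * (A (a + p * j) * harmonic (L * (a + p * j)))))"
      unfolding M_def F'_def n fps_sub_nth fps_mult_left_const_nth
        fps_compose_X_power_mult_nth[OF a] sum_subtractf sum_distrib_left[symmetric]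
      by (simp add: F_def G_def mult_ac)
    then show ?thesis using harmonic_congruence[OF a] by simp
  qed
  then have "\<forall>n. \<exists>y\<in>Zp. fps_nth M n = of_nat p * y" by (auto simp: pid_def)
  then obtain y where y: "\<And>n. y n \<in> Zp" "\<And>n. fps_nth M n = of_nat p * y n" by metis
  \<comment> \<open>\<open>T\<close> is \<open>- M / (p F F')\<close>; it is integral because
    \<open>F\<close> and \<open>F'\<close> are integral with constant term 1.\<close>
  define T where "T = - (Abs_fps y * inverse F * inverse F')"
  have M: "M = fps_const (of_nat p) * Abs_fps y"
    by (rule fps_ext) (simp add: y)
  have "fps_nth M 0 = 0" by (simp add: M_def G0)
  then have "y 0 = 0" using y(2)[of 0] by simp
  then have T0: "fps_nth T 0 = 0" by (simp add: T_def)
  have "Abs_fps y * inverse F * inverse F' \<in> fps_pid 1"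
    using y(1) F F' by (intro fps_pid_1_mult fps_pid_inverse) (auto simp: fps_pid_def)
  then have T: "T \<in> fps_pid 1"
    unfolding T_def using fps_pid_diff[OF fps_pid_0] by force
  have "M = - ((fps_const (of_nat p) * S - (S oo fps_X ^ p)) * (F * F'))"
    unfolding M_def GF' by (subst GF) (simp add: algebra_simps)
  then have "M * (inverse F * inverse F')
      = - ((fps_const (of_nat p) * S - (S oo fps_X ^ p)) * ((F * inverse F) * (F' * inverse F')))"
    by (simp only: mult_ac minus_mult_left)
  then have "fps_const (of_nat p) * S - (S oo fps_X ^ p) = - (M * (inverse F * inverse F'))"
    unfolding invF invF' by simp
  also have "\<dots> = fps_const (of_nat p) * T"
    unfolding M T_def by (simp add: mult_ac)
  finally have "fps_const (of_nat p) * S - (S oo fps_X ^ p) = fps_const (of_nat p) * T" .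
  from fps_exp_compose_integral[OF S0 T0 T this] show ?thesis by (simp add: S_def)
qed

end

theorem theorem1:
  fixes k N L :: nat
  assumes "k \<ge> 1" and "N \<ge> 1" and "L \<in> {1..N}"
  shows "\<forall>n. fps_nth (q_ser k L N) n \<in> \<int>"
proof
  fix n
  let ?A = "\<lambda>m. multinom N m ^ k"
  have coeff: "multinom N m ^ k = fact (N * m) ^ k / fact m ^ (k * N)" for m
    by (simp add: multinom_def power_divide mult.commute flip: power_mult)
  have F: "F_ser k N = Abs_fps ?A"
    by (simp add: F_ser_def coeff)
  \<comment> \<open>At \<open>m = 0\<close> the factor \<open>harmonic 0 = 0\<close> accounts for
    the case distinction in \<open>G_ser\<close>.\<close>
  have G: "G_ser k L N = Abs_fps (\<lambda>m. ?A m * harmonic (L * m))"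
    by (rule fps_ext) (simp add: G_ser_def coeff harmonic_def)
  show "fps_nth (q_ser k L N) n \<in> \<int>"
  proof (rule rat_integral_at_all_primes)
    fix p :: nat
    assume p: "prime p"
    interpret padic p using p by unfold_locales
    interpret dwork_sequence p ?A
      "\<lambda>v w. (of_nat (ratio_num N v w) / of_nat (ratio_den N v w)) ^ k"
      by (rule multinom_power_dwork)
    interpret dwork_harmonic p ?A
      "\<lambda>v w. (of_nat (ratio_num N v w) / of_nat (ratio_den N v w)) ^ k" L
      by unfold_locales (use assms in \<open>auto intro: multinom_harmonic\<close>)
    have "q_ser k L N \<in> fps_pid 1"
      unfolding q_ser_def F G by (rule fps_exp_ratio_integral)
    then show "fps_nth (q_ser k L N) n \<in> Zp"
      using fps_pidD by fastforce
  qed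
qed

end
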